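(* Let $\mathcal H$ be a separable Hilbert space, let $\mathcal W_w=\{(\mathcal W_i,w_i)\}_{i\in I}$ be a fusion Bessel sequence in $\mathcal H$ with bound $B>0$, let $J\subsetneq I$, and let $T_{\mathcal W}$ be the synthesis operator associated with $\{(\mathcal W_i,w_i)\}_{i\in I\setminus J}$. Let $a,b,c\ge 0$ and let $K\in\mathcal L(\mathcal H)$ be an operator with closed range such that $$\|(K^*-T_{\mathcal W}T_{\mathcal W}^* )f\|\le a\|K^*f\|+b\|T_{\mathcal W}^*f\|+c\|f\|\quad\text{for all } f\in\mathcal H.$$ If $a+c\|K^{\dagger}\|<1$, then $\{(\mathcal W_i,w_i)\}_{i\in I\setminus J}$ is a $K$-fusion frame for $R(K)$ with bounds $\left(\frac{1-a-c\|K^{\dagger}\|}{b+\|T_{\mathcal W}\|}\right)^2$ and $B$.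
   Context: $\mathcal L(\mathcal H)$ is the space of bounded linear operators on $\mathcal H$; $R(K)$ is the range of $K$. The index set $I$ is finite or countable. $P_{\mathcal W}$ is the orthogonal projection onto a closed subspace $\mathcal W$. For an operator $K$ with closed range, $K^{\dagger}$ denotes its Moore–Penrose pseudo-inverse. A weighted collection $\{(\mathcal W_i,w_i)\}_{i\in I}$ consists of closed subspaces $\mathcal W_i$ of $\mathcal H$ and real scalars $w_i$. It is a fusion Bessel sequence with bound $B>0$ if $\sum_{i\in I}w_i^2\|P_{\mathcal W_i}f\|^2\le B\|f\|^2$ for all $f\in\mathcal H$. A collection $\{(\mathcal W_i,w_i)\}_{i\in I\setminus J}$ is a $K$-fusion frame for $R(K)$ with bounds $A',B'>0$ if $A'\|K^*f\|^2\le\sum_{i\in I\setminus J}w_i^2\|P_{\mathcal W_i}f\|^2\le B'\|f\|^2$ for all $f\in R(K)$. The synthesis operator associated with $\{(\mathcal W_i,w_i)\}_{i\in I\setminus J}$ is the bounded operator $T_{\mathcal W}:\left(\sum_{i\in I\setminus J}\bigoplus\mathcal W_i\right)_{l^2}\to\mathcal H$, $T_{\mathcal W}(\{f_i\})=\sum_{i\in I\setminus J}w_if_i$, where $\left(\sum_{i\in I\setminus J}\bigoplus\mathcal W_i\right)_{l^2}=\{\{f_i\}:f_i\in\mathcal W_i,\ \sum\|f_i\|^2<\infty\}$ with inner product $\langle\{f_i\},\{g_i\}\rangle=\sum\langle f_i,g_i\rangle$; its adjoint is $T_{\mathcal W}^*f=\{w_iP_{\mathcal W_i}f\}_{i\in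 I\setminus J}$. The expression for the lower bound presupposes $b+\|T_{\mathcal W}\|\neq 0$. *)

theory Defs
  imports "HOL-Analysis.Analysis"
begin

text \<open>
  The scalars form a finite-dimensional real normed field whose norm comes from a real inner
  product, that is, the field of real or of complex numbers. On such a field \<open>z \<bullet> 1\<close> is the
  real part, and conjugation is twice the real part minus the identity.
\<close>

definition conjugate :: "'k::{real_normed_field,euclidean_space} \<Rightarrow> 'k" where
  "conjugate z = of_real (2 * (z \<bullet> 1)) - z"

lemma conjugate_real: "conjugate (x::real) = x"
  by (simp add: conjugate_def)

lemma conjugate_complex: "conjugate z = cnj z"
  by (simp add: conjugate_def complex_eq_iff inner_complex_def)

text \<open>
  The class \<open>real_inner\<close> supplies norm and topology; its inner product is the real part of
  \<open>ip\<close>, as follows from \<open>ip_self\<close> by polarization, so it is no additional structure.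
\<close>

locale hilbert_space = vector_space smul
  for smul :: "'k::{real_normed_field,euclidean_space} \<Rightarrow> 'h::{real_inner,banach} \<Rightarrow> 'h" +
  fixes ip :: "'h \<Rightarrow> 'h \<Rightarrow> 'k"
  assumes scale_of_real: "smul (of_real r) x = r *\<^sub>R x"
    and ip_add_left: "ip (x + y) z = ip x z + ip y z"
    and ip_scale_left: "ip (smul c x) y = c * ip x y"
    and ip_commute: "ip y x = conjugate (ip x y)"
    and ip_self: "ip x x = of_real ((norm x)\<^sup>2)"

lemma hilbert_space_real:
  "hilbert_space (scaleR :: real \<Rightarrow> 'h::{real_inner,banach} \<Rightarrow> 'h) inner"
  by unfold_locales
    (simp_all add: algebra_simps inner_add_left conjugate_real inner_commute power2_norm_eq_inner)

lemma hilbert_space_complex: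
  "hilbert_space (\<lambda>c z. c * z :: complex) (\<lambda>z w. z * cnj w)"
  by unfold_locales
    (simp_all add: algebra_simps conjugate_complex scaleR_conv_of_real complex_norm_square
      del: of_real_power)

definition bounded_operator :: "('k::field \<Rightarrow> 'h::real_normed_vector \<Rightarrow> 'h) \<Rightarrow> ('h \<Rightarrow> 'h) \<Rightarrow> bool" where
  "bounded_operator smul K \<longleftrightarrow>
     Vector_Spaces.linear smul smul K \<and> (\<exists>C. \<forall>x. norm (K x) \<le> C * norm x)"

text \<open>
  Adjoint and norm of an operator whose domain is the Hilbert space carried by the set \<open>X\<close>,
  with inner product \<open>ipX\<close> and norm \<open>normX\<close>.
\<close>

definition adjoint_on :: "'x set \<Rightarrow> ('x \<Rightarrow> 'x \<Rightarrow> 'k) \<Rightarrow> ('y \<Rightarrow> 'y \<Rightarrow> 'k) \<Rightarrow> ('x \<Rightarrow> 'y) \<Rightarrow> 'y \<Rightarrow> 'x" where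
  "adjoint_on X ipX ipY T y = (THE x. x \<in> X \<and> (\<forall>u\<in>X. ipY (T u) y = ipX u x))"

definition onorm_on :: "'x set \<Rightarrow> ('x \<Rightarrow> real) \<Rightarrow> ('x \<Rightarrow> 'y::real_normed_vector) \<Rightarrow> real" where
  "onorm_on X normX T = (SUP x\<in>X. norm (T x) / normX x)"

abbreviation adj :: "('h \<Rightarrow> 'h \<Rightarrow> 'k) \<Rightarrow> ('h \<Rightarrow> 'h) \<Rightarrow> 'h \<Rightarrow> 'h" where
  "adj ip K \<equiv> adjoint_on UNIV ip ip K"

text \<open>The last two of the four Penrose equations say that \<open>K L\<close> and \<open>L K\<close> are self-adjoint.\<close>

definition pseudo_inverse ::
  "('k::field \<Rightarrow> 'h::real_normed_vector \<Rightarrow> 'h) \<Rightarrow> ('h \<Rightarrow> 'h \<Rightarrow> 'k) \<Rightarrow> ('h \<Rightarrow> 'h) \<Rightarrow> 'h \<Rightarrow> 'h" where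
  "pseudo_inverse smul ip K = (THE L. bounded_operator smul L \<and>
     (\<forall>x. K (L (K x)) = K x) \<and> (\<forall>x. L (K (L x)) = L x) \<and>
     (\<forall>x y. ip (K (L x)) y = ip x (K (L y))) \<and> (\<forall>x y. ip (L (K x)) y = ip x (L (K y))))"

definition orth_proj :: "('h::ab_group_add \<Rightarrow> 'h \<Rightarrow> 'k::zero) \<Rightarrow> 'h set \<Rightarrow> 'h \<Rightarrow> 'h" where
  "orth_proj ip M f = (THE p. p \<in> M \<and> (\<forall>u\<in>M. ip (f - p) u = 0))"

definition closed_subspaces ::
  "('k::field \<Rightarrow> 'h::{ab_group_add,topological_space} \<Rightarrow> 'h) \<Rightarrow> 'i set \<Rightarrow> ('i \<Rightarrow> 'h set) \<Rightarrow> bool" where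
  "closed_subspaces smul I W \<longleftrightarrow> (\<forall>i\<in>I. module.subspace smul (W i) \<and> closed (W i))"

text \<open>
  Summability is demanded explicitly wherever an infinite sum is bounded, because \<open>infsum\<close> is
  \<open>0\<close> on families that are not summable.
\<close>

definition fusion_bessel ::
  "('k::field \<Rightarrow> 'h::real_normed_vector \<Rightarrow> 'h) \<Rightarrow> ('h \<Rightarrow> 'h \<Rightarrow> 'k) \<Rightarrow>
   'i set \<Rightarrow> ('i \<Rightarrow> 'h set) \<Rightarrow> ('i \<Rightarrow> real) \<Rightarrow> real \<Rightarrow> bool" where
  "fusion_bessel smul ip I W w B \<longleftrightarrow>
     closed_subspaces smul I W \<and> B > 0 \<and>
     (\<forall>f. (\<lambda>i. (w i)\<^sup>2 * (norm (orth_proj ip (W i) f))\<^sup>2) summable_on I \<and>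
          (\<Sum>\<^sub>\<infinity>i\<in>I. (w i)\<^sup>2 * (norm (orth_proj ip (W i) f))\<^sup>2) \<le> B * (norm f)\<^sup>2)"

definition K_fusion_frame_on_range ::
  "('k::field \<Rightarrow> 'h::real_normed_vector \<Rightarrow> 'h) \<Rightarrow> ('h \<Rightarrow> 'h \<Rightarrow> 'k) \<Rightarrow> ('h \<Rightarrow> 'h) \<Rightarrow>
   'i set \<Rightarrow> ('i \<Rightarrow> 'h set) \<Rightarrow> ('i \<Rightarrow> real) \<Rightarrow> real \<Rightarrow> real \<Rightarrow> bool" where
  "K_fusion_frame_on_range smul ip K I W w A B \<longleftrightarrow>
     closed_subspaces smul I W \<and> A > 0 \<and> B > 0 \<and>
     (\<forall>f\<in>range K. (\<lambda>i. (w i)\<^sup>2 * (norm (orth_proj ip (W i) f))\<^sup>2) summable_on I \<and>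
          A * (norm (adj ip K f))\<^sup>2 \<le> (\<Sum>\<^sub>\<infinity>i\<in>I. (w i)\<^sup>2 * (norm (orth_proj ip (W i) f))\<^sup>2) \<and>
          (\<Sum>\<^sub>\<infinity>i\<in>I. (w i)\<^sup>2 * (norm (orth_proj ip (W i) f))\<^sup>2) \<le> B * (norm f)\<^sup>2)"

text \<open>
  Families indexed by \<open>I\<close> are functions vanishing off \<open>I\<close>, so that equal families are equal
  functions.
\<close>

definition l2_sum :: "'i set \<Rightarrow> ('i \<Rightarrow> 'h::real_normed_vector set) \<Rightarrow> ('i \<Rightarrow> 'h) set" where
  "l2_sum I W = {g. (\<forall>i\<in>I. g i \<in> W i) \<and> (\<forall>i. i \<notin> I \<longrightarrow> g i = 0) \<and>
                    (\<lambda>i. (norm (g i))\<^sup>2) summable_on I}"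

definition l2_ip ::
  "('h \<Rightarrow> 'h \<Rightarrow> 'k::{comm_monoid_add,t2_space}) \<Rightarrow> 'i set \<Rightarrow> ('i \<Rightarrow> 'h) \<Rightarrow> ('i \<Rightarrow> 'h) \<Rightarrow> 'k" where
  "l2_ip ip I g h = (\<Sum>\<^sub>\<infinity>i\<in>I. ip (g i) (h i))"

definition l2_norm :: "'i set \<Rightarrow> ('i \<Rightarrow> 'h::real_normed_vector) \<Rightarrow> real" where
  "l2_norm I g = sqrt (\<Sum>\<^sub>\<infinity>i\<in>I. (norm (g i))\<^sup>2)"

definition synthesis :: "'i set \<Rightarrow> ('i \<Rightarrow> real) \<Rightarrow> ('i \<Rightarrow> 'h::real_normed_vector) \<Rightarrow> 'h" where
  "synthesis I w g = (\<Sum>\<^sub>\<infinity>i\<in>I. w i *\<^sub>R g i)"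

definition synthesis_adj ::
  "('h::real_normed_vector \<Rightarrow> 'h \<Rightarrow> 'k::{comm_monoid_add,t2_space}) \<Rightarrow>
   'i set \<Rightarrow> ('i \<Rightarrow> 'h set) \<Rightarrow> ('i \<Rightarrow> real) \<Rightarrow> 'h \<Rightarrow> 'i \<Rightarrow> 'h" where
  "synthesis_adj ip I W w = adjoint_on (l2_sum I W) (l2_ip ip I) ip (synthesis I w)"

definition synthesis_norm ::
  "'i set \<Rightarrow> ('i \<Rightarrow> 'h::real_normed_vector set) \<Rightarrow> ('i \<Rightarrow> real) \<Rightarrow> real" where
  "synthesis_norm I W w = onorm_on (l2_sum I W) (l2_norm I) (synthesis I w)"

end

theory Submission
  imports Defs
begin

text \<open>
  The upper bound is inherited from the Bessel sequence by dropping terms. For the lower bound write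
  \<open>T\<close> for the synthesis operator, \<open>L\<close> for the pseudo-inverse of \<open>K\<close> and \<open>K\<^sup>*\<close> for its adjoint. If \<open>f\<close> is in
  the range of \<open>K\<close>, then \<open>f = K (L f)\<close>, hence
  \<open>(norm f)\<^sup>2 = inner (L f) (K\<^sup>* f)\<close> and \<open>norm f \<le> onorm L * norm (K\<^sup>* f)\<close>. The hypothesis then yields
  \<open>norm (K\<^sup>* f) \<le> a * norm (K\<^sup>* f) + b * norm (T\<^sup>* f) + c * onorm L * norm (K\<^sup>* f) + norm (T (T\<^sup>* f))\<close>,
  that is, \<open>(1 - a - c * onorm L) * norm (K\<^sup>* f) \<le> (b + norm T) * norm (T\<^sup>* f)\<close>. Finally
  \<open>(norm (T\<^sup>* f))\<^sup>2\<close> is the sum of the \<open>(w i)\<^sup>2 * (norm (P\<^sub>i f))\<^sup>2\<close>, where \<open>P\<^sub>i\<close> projects onto \<open>W i\<close>.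

  What this argument takes for granted is that the objects in it exist: adjoints, projections
  and pseudo-inverses are introduced by definite descriptions, and the norm of \<open>T\<close> by a supremum. The
  substantial points are the boundedness of the pseudo-inverse, which rests on the Baire category
  theorem (\<open>bounded_below_on_kernel_complement\<close>, \<open>penrose_inverse_exists\<close>), and the identification of
  the adjoint of \<open>T\<close> with \<open>f \<mapsto> (w i *\<^sub>R P\<^sub>i f)\<^sub>i\<close> on the \<open>l2\<close> sum (\<open>norm_weighted_sum_le\<close>,
  \<open>synthesis_adj_eq\<close>).

  The geometry is carried out for the real inner product. It transfers to the scalar-valued one
  because a scalar is determined by the real parts of its multiples (\<open>ip_eqI\<close>), which makes the
  argument uniform in the real and the complex case.
\<close>

section \<open>Projections and bounded inverses in real Hilbert spaces\<close>

text \<open>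
  By the parallelogram law the midpoint of two near-minimizers would beat the infimum if they were
  far apart. This makes every minimizing sequence a Cauchy sequence, so that a nearest point
  exists without any compactness.
\<close>

lemma norm_minus_le_of_near_minimizers:
  fixes f :: "'h::real_inner"
  assumes "subspace M" "u \<in> M" "v \<in> M"
    and d: "\<And>x. x \<in> M \<Longrightarrow> d \<le> (norm (f - x))\<^sup>2"
    and "(norm (f - u))\<^sup>2 \<le> d + e" "(norm (f - v))\<^sup>2 \<le> d + e"
  shows "(norm (u - v))\<^sup>2 \<le> 4 * e"
proof -
  define x where "x = (1/2) *\<^sub>R (u + v)"
  have "x \<in> M"
    unfolding x_def using assms(1-3) by (simp add: subspace_add subspace_scale)
  have "4 * (norm (f - x))\<^sup>2 + (norm (u - v))\<^sup>2 = 2 * (norm (f - u))\<^sup>2 + 2 * (norm (f - v))\<^sup>2"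
    unfolding x_def power2_norm_eq_inner
    by (simp add: inner_add_left inner_add_right inner_diff_left inner_diff_right inner_commute field_simps)
  then show ?thesis
    using d[OF \<open>x \<in> M\<close>] assms(5,6) by linarith
qed

text \<open>
  The projection is the limit of a minimizing sequence for the distance to \<open>f\<close>. It is orthogonal
  to the residual because the distance cannot decrease along any line in \<open>M\<close> through it.
\<close>

lemma orthogonal_projection_exists:
  fixes M :: "'h::{real_inner,banach} set"
  assumes M: "subspace M" "closed M"
  obtains p where "p \<in> M" "\<And>u. u \<in> M \<Longrightarrow> inner (f - p) u = 0"
proof -
  define d where "d = (INF x\<in>M. (norm (f - x))\<^sup>2)"
  have bdd: "bdd_below ((\<lambda>x. (norm (f - x))\<^sup>2) ` M)"
    by (rule bdd_belowI2[of _ 0]) simp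
  have ne: "M \<noteq> {}" using subspace_0[OF M(1)] by auto
  have d: "d \<le> (norm (f - x))\<^sup>2" if "x \<in> M" for x
    unfolding d_def using bdd that by (rule cINF_lower)
  have "\<exists>u\<in>M. (norm (f - u))\<^sup>2 \<le> d + inverse (real (Suc n))" for n
  proof -
    have "d < d + inverse (real (Suc n))" by simp
    then show ?thesis
      unfolding d_def using cINF_less_iff[OF ne bdd] by (meson less_imp_le)
  qed
  then obtain u where u: "\<And>n. u n \<in> M" "\<And>n. (norm (f - u n))\<^sup>2 \<le> d + inverse (real (Suc n))"
    by metis
  have "Cauchy u"
  proof (rule metric_CauchyI)
    fix e :: real assume "e > 0"
    then have "e\<^sup>2 / 4 > 0" by simp
    then obtain N where N: "inverse (real (Suc N)) < e\<^sup>2 / 4"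
      using reals_Archimedean by blast
    have "dist (u m) (u n) < e" if "m \<ge> N" "n \<ge> N" for m n
    proof -
      have "inverse (real (Suc k)) \<le> inverse (real (Suc N))" if "k \<ge> N" for k
        using that by (simp add: field_simps)
      then have "(norm (u m - u n))\<^sup>2 \<le> 4 * inverse (real (Suc N))"
        using u that
        by (intro norm_minus_le_of_near_minimizers[OF M(1) u(1) u(1) d]) (meson add_left_mono order_trans)+
      then have "(norm (u m - u n))\<^sup>2 < e\<^sup>2" using N by linarith
      then show ?thesis using \<open>e > 0\<close> by (simp add: dist_norm power2_less_imp_less)
    qed
    then show "\<exists>N. \<forall>m\<ge>N. \<forall>n\<ge>N. dist (u m) (u n) < e" by blast
  qed
  then obtain p where lim: "u \<longlonglongrightarrow> p" using Cauchy_convergent_iff convergent_def by blast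
  have "p \<in> M" using closed_sequentially[OF M(2)] u(1) lim by blast
  have "(norm (f - p))\<^sup>2 \<le> d"
  proof (rule LIMSEQ_le)
    show "(\<lambda>n. (norm (f - u n))\<^sup>2) \<longlonglongrightarrow> (norm (f - p))\<^sup>2" by (intro tendsto_intros lim)
    show "(\<lambda>n. d + inverse (real (Suc n))) \<longlonglongrightarrow> d"
      using tendsto_add[OF tendsto_const LIMSEQ_inverse_real_of_nat, of d] by simp
  qed (use u(2) in auto)
  have "inner (f - p) v = 0" if "v \<in> M" for v
  proof (cases "v = 0")
    case False
    \<comment> \<open>the minimizer of the quadratic \<open>t \<mapsto> (norm (f - p - t *\<^sub>R v))\<^sup>2\<close>\<close>
    define t where "t = inner (f - p) v / inner v v"
    have "p + t *\<^sub>R v \<in> M" using M \<open>p \<in> M\<close> that by (simp add: subspace_add subspace_scale)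
    then have "d \<le> (norm (f - (p + t *\<^sub>R v)))\<^sup>2" by (rule d)
    with \<open>(norm (f - p))\<^sup>2 \<le> d\<close>
    have "(norm (f - p))\<^sup>2 \<le> (norm (f - p - t *\<^sub>R v))\<^sup>2"
      unfolding diff_diff_add by linarith
    also have "\<dots> = (norm (f - p))\<^sup>2 - 2 * t * inner (f - p) v + t\<^sup>2 * inner v v"
      unfolding power2_norm_eq_inner
      by (simp add: inner_diff_left inner_diff_right inner_commute power2_eq_square algebra_simps)
    also have "\<dots> = (norm (f - p))\<^sup>2 - (inner (f - p) v)\<^sup>2 / inner v v"
      using False unfolding t_def by (simp add: power2_eq_square field_simps)
    finally have "(inner (f - p) v)\<^sup>2 / inner v v \<le> 0" by simp
    moreover have "inner v v > 0" using False by simp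
    ultimately show ?thesis by (simp add: divide_le_0_iff)
  qed simp
  with \<open>p \<in> M\<close> show ?thesis by (rule that)
qed

text \<open>
  The kernel of a nonzero functional has codimension one, so the representing vector is a multiple
  of any nonzero vector \<open>q\<close> orthogonal to it.
\<close>

lemma riesz_representation:
  fixes \<phi> :: "'h::{real_inner,banach} \<Rightarrow> real"
  assumes "bounded_linear \<phi>"
  obtains z where "\<And>x. \<phi> x = inner x z"
proof (cases "\<forall>x. \<phi> x = 0")
  case True
  then show ?thesis using that[of 0] by simp
next
  case False
  interpret bounded_linear \<phi> by fact
  define N where "N = {x. \<phi> x = 0}"
  have "subspace N" unfolding N_def subspace_def by (simp add: zero add scaleR)
  moreover have "closed N"
    unfolding N_def by (intro closed_Collect_eq continuous_intros continuous_on)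
  moreover obtain x0 where x0: "\<phi> x0 \<noteq> 0" using False by blast
  ultimately obtain p where p: "p \<in> N" "\<And>u. u \<in> N \<Longrightarrow> inner (x0 - p) u = 0"
    using orthogonal_projection_exists by blast
  define q where "q = x0 - p"
  have q: "\<phi> q \<noteq> 0" using p(1) x0 by (simp add: q_def diff N_def)
  then have "q \<noteq> 0" using zero by auto
  show ?thesis
  proof (rule that)
    fix x
    have "x - (\<phi> x / \<phi> q) *\<^sub>R q \<in> N" using q by (simp add: N_def diff scaleR)
    from p(2)[OF this] have "inner x q = \<phi> x / \<phi> q * inner q q"
      unfolding q_def[symmetric] by (simp add: inner_diff_right inner_commute)
    then show "\<phi> x = inner x ((\<phi> q / inner q q) *\<^sub>R q)"
      using q \<open>q \<noteq> 0\<close> by (simp add: field_simps)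
  qed
qed

lemma real_adjoint_exists:
  fixes K :: "'h::{real_inner,banach} \<Rightarrow> 'g::real_inner"
  assumes "bounded_linear K"
  obtains A where "\<And>x y. inner (K x) y = inner x (A y)"
proof -
  have "\<exists>z. \<forall>x. inner (K x) y = inner x z" for y
    using riesz_representation[OF bounded_linear_inner_left_comp[OF assms, of y]] by metis
  then show ?thesis using that by metis
qed

text \<open>
  The uniform boundedness principle for the functionals \<open>inner f\<close>, \<open>f \<in> F\<close>. By the Baire category
  theorem in \<open>S\<close>, one of the sets \<open>E n\<close> of points at which all of them are bounded by \<open>n\<close> has
  interior. On the ball found there they vary by at most \<open>2 * n\<close>, and testing \<open>f\<close> on a displacement
  in its own direction, which stays in \<open>S\<close>, bounds \<open>norm f\<close>.
\<close>

lemma weakly_bounded_imp_bounded: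
  fixes S :: "'h::{real_inner,banach} set"
  assumes S: "subspace S" "closed S" and "F \<subseteq> S"
    and bdd: "\<And>g. g \<in> S \<Longrightarrow> \<exists>c. \<forall>f\<in>F. \<bar>inner f g\<bar> \<le> c"
  obtains C where "C \<ge> 0" "\<And>f. f \<in> F \<Longrightarrow> norm f \<le> C"
proof -
  define E where "E n = {g \<in> S. \<forall>f\<in>F. \<bar>inner f g\<bar> \<le> real n}" for n
  have E_closed: "closedin (top_of_set S) (E n)" for n
  proof -
    have "E n = S \<inter> (\<Inter>f\<in>F. {g. \<bar>inner f g\<bar> \<le> real n})" by (auto simp: E_def)
    moreover have "closed (\<Inter>f\<in>F. {g. \<bar>inner f g\<bar> \<le> real n})"
      by (intro closed_INT ballI closed_Collect_le continuous_intros)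
    ultimately show ?thesis using closedin_closed by blast
  qed
  have "(\<Union>n. E n) = S"
  proof -
    have "\<exists>n. g \<in> E n" if g: "g \<in> S" for g
    proof -
      obtain c where c: "\<forall>f\<in>F. \<bar>inner f g\<bar> \<le> c" using bdd[OF g] by blast
      obtain n where "c \<le> real n" using real_arch_simple by blast
      then show ?thesis unfolding E_def using c g by (fastforce intro: order_trans)
    qed
    then show ?thesis by (auto simp: E_def)
  qed
  moreover have "top_of_set S interior_of S = S"
    using interior_of_topspace[of "top_of_set S"] by simp
  moreover have "completely_metrizable_space (top_of_set S)"
    using S(2) completely_metrizable_space_closedin[OF completely_metrizable_space_euclidean] by simp
  ultimately have "\<exists>n. top_of_set S interior_of E n \<noteq> {}"
    using Baire_category_alt[of "top_of_set S" "range E"] E_closed subspace_0[OF S(1)] by auto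
  then obtain n g0 where "g0 \<in> top_of_set S interior_of E n" by blast
  then obtain U where U: "openin (top_of_set S) U" "g0 \<in> U" "U \<subseteq> E n"
    by (auto simp: interior_of_def)
  then obtain r where r: "r > 0" "\<And>g. g \<in> S \<Longrightarrow> dist g g0 < r \<Longrightarrow> g \<in> U"
    unfolding openin_euclidean_subtopology_iff by blast
  have g0: "g0 \<in> S" "g0 \<in> E n" using U unfolding E_def by auto
  have "norm f \<le> 4 * real n / r" if f: "f \<in> F" for f
  proof (cases "f = 0")
    case False
    define h where "h = (r / 2 / norm f) *\<^sub>R f"
    have "g0 + h \<in> S" using f \<open>F \<subseteq> S\<close> g0 S by (auto simp: h_def subspace_add subspace_scale)
    moreover have "dist (g0 + h) g0 < r" using r False by (simp add: h_def dist_norm)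
    ultimately have "g0 + h \<in> E n" using r(2) U(3) by blast
    then have "\<bar>inner f (g0 + h)\<bar> \<le> real n" "\<bar>inner f g0\<bar> \<le> real n" using g0 f unfolding E_def by auto
    then have "inner f h \<le> 2 * real n" by (simp add: inner_add_right)
    moreover have "inner f h = r / 2 * norm f"
      using False by (simp add: h_def flip: power2_norm_eq_inner) (simp add: power2_eq_square)
    ultimately show ?thesis using r by (simp add: field_simps)
  qed (use r in simp)
  then show ?thesis using r by (intro that[of "4 * real n / r"]) auto
qed

lemma subspace_closure:
  fixes S :: "'h::real_normed_vector set"
  assumes "subspace S"
  shows "subspace (closure S)"
proof (rule subspaceI)
  show "0 \<in> closure S" using subspace_0[OF assms] closure_subset by blast
  show "x + y \<in> closure S" if "x \<in> closure S" "y \<in> closure S" for x y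
    using that subspace_add[OF assms] unfolding closure_sequential
    by (metis (mono_tags, lifting) tendsto_add)
  show "c *\<^sub>R x \<in> closure S" if "x \<in> closure S" for c x
    using that subspace_scale[OF assms] unfolding closure_sequential
    by (metis (mono_tags, lifting) tendsto_const tendsto_scaleR)
qed

text \<open>
  The bounded inverse theorem for an operator with closed range, in the form in which it makes the
  Moore-Penrose inverse bounded. Let \<open>A\<close> be the adjoint of \<open>K\<close>. Since \<open>inner f (K x) = inner x (A f)\<close>,
  the vectors \<open>f\<close> of the range with \<open>norm (A f) \<le> 1\<close> are weakly bounded on the range, hence bounded:
  \<open>norm f \<le> C * norm (A f)\<close> there. By duality
  \<open>\<bar>inner x y\<bar> \<le> C * norm (K x) * norm y\<close> for \<open>y\<close> in the range of \<open>A\<close>, and by continuity for \<open>y\<close> in its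
  closure. This closure is the orthogonal complement of the kernel, so \<open>y = x\<close> is admitted.
\<close>

lemma bounded_below_on_kernel_complement:
  fixes K :: "'h::{real_inner,banach} \<Rightarrow> 'h"
  assumes K: "bounded_linear K" and closed_range: "closed (range K)"
  obtains C where "C \<ge> 0"
    and "\<And>x. (\<And>n. K n = 0 \<Longrightarrow> inner x n = 0) \<Longrightarrow> norm x \<le> C * norm (K x)"
proof -
  interpret bounded_linear K by fact
  obtain A where A: "\<And>x y. inner (K x) y = inner x (A y)"
    using real_adjoint_exists[OF K] by blast
  have A_lin: "linear A"
  proof (rule linearI)
    show "A (x + y) = A x + A y" for x y
      by (rule vector_eq_ldot[THEN iffD1]) (simp add: A[symmetric] inner_add_right)
    show "A (r *\<^sub>R x) = r *\<^sub>R A x" for r x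
      by (rule vector_eq_ldot[THEN iffD1]) (simp add: A[symmetric])
  qed
  have R: "subspace (range K)" using linear_subspace_image[OF linear_axioms subspace_UNIV] .
  define F where "F = {f \<in> range K. norm (A f) \<le> 1}"
  have "\<exists>c. \<forall>f\<in>F. \<bar>inner f g\<bar> \<le> c" if g: "g \<in> range K" for g
  proof -
    obtain x where x: "g = K x" using g by blast
    have "\<bar>inner f g\<bar> \<le> norm x" if f: "f \<in> F" for f
    proof -
      have "\<bar>inner f g\<bar> = \<bar>inner x (A f)\<bar>" by (simp add: x A[symmetric] inner_commute)
      also have "\<dots> \<le> norm x * norm (A f)" by (rule Cauchy_Schwarz_ineq2)
      also have "\<dots> \<le> norm x" using f by (simp add: F_def mult_left_le)
      finally show ?thesis .
    qed
    then show ?thesis by blast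
  qed
  then obtain C where C: "C \<ge> 0" "\<And>f. f \<in> F \<Longrightarrow> norm f \<le> C"
    using weakly_bounded_imp_bounded[OF R closed_range, of F] unfolding F_def by blast
  have below_range: "norm f \<le> C * norm (A f)" if f: "f \<in> range K" for f
  proof (cases "A f = 0")
    case True
    obtain x where "f = K x" using f by blast
    then have "inner f f = 0" using A[of x f] True by simp
    then show ?thesis using C by simp
  next
    case False
    define h where "h = (1 / norm (A f)) *\<^sub>R f"
    have "h \<in> F" using f R False linear_scale[OF A_lin] unfolding F_def h_def
      by (simp add: subspace_scale)
    then show ?thesis using C(2)[of h] False unfolding h_def by (simp add: field_simps)
  qed
  \<comment> \<open>the component of \<open>f\<close> orthogonal to the range of \<open>K\<close> is annihilated by \<open>A\<close>\<close>
  have weak: "\<bar>inner x (A f)\<bar> \<le> C * norm (K x) * norm (A f)" for x f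
  proof -
    obtain p where p: "p \<in> range K" "\<And>u. u \<in> range K \<Longrightarrow> inner (f - p) u = 0"
      using orthogonal_projection_exists[OF R closed_range] by blast
    have "inner u (A (f - p)) = 0" for u
      using p(2)[of "K u"] by (simp add: A[symmetric] inner_commute)
    then have "A (f - p) = 0" using inner_eq_zero_iff by blast
    then have Af: "A f = A p" using linear_diff[OF A_lin] by simp
    have "\<bar>inner x (A f)\<bar> = \<bar>inner (K x) p\<bar>" by (simp add: Af A)
    also have "\<dots> \<le> norm (K x) * norm p" by (rule Cauchy_Schwarz_ineq2)
    also have "\<dots> \<le> norm (K x) * (C * norm (A f))"
      unfolding Af by (intro mult_left_mono below_range p) simp
    finally show ?thesis by (simp add: algebra_simps)
  qed
  show ?thesis
  proof (rule that[OF C(1)])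
    fix x assume x: "\<And>n. K n = 0 \<Longrightarrow> inner x n = 0"
    have RA: "subspace (range A)" using linear_subspace_image[OF A_lin subspace_UNIV] .
    have "subspace (closure (range A))" using RA by (rule subspace_closure)
    then obtain p where p: "p \<in> closure (range A)" "\<And>u. u \<in> closure (range A) \<Longrightarrow> inner (x - p) u = 0"
      using orthogonal_projection_exists[OF _ closed_closure] by blast
    have "inner (K (x - p)) u = 0" for u
      using p(2)[of "A u"] closure_subset[of "range A"] by (auto simp: A)
    then have "K (x - p) = 0" using inner_eq_zero_iff by blast
    then have "inner x (x - p) = 0" using x by blast
    moreover have "inner p (x - p) = 0" using p by (simp add: inner_commute)
    ultimately have "inner (x - p) (x - p) = 0" by (simp add: inner_diff_left)
    then have "x \<in> closure (range A)" using p(1) by simp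
    moreover have "closure (range A) \<subseteq> {y. \<bar>inner x y\<bar> \<le> C * norm (K x) * norm y}"
      by (rule closure_minimal) (use weak in \<open>auto intro!: closed_Collect_le continuous_intros\<close>)
    ultimately have "norm x * norm x \<le> C * norm (K x) * norm x"
      by (auto simp: dot_square_norm power2_eq_square)
    then show "norm x \<le> C * norm (K x)"
      using C(1) by (cases "x = 0") auto
  qed
qed

section \<open>Summability from norm bounds on partial sums\<close>

text \<open>
  Cauchy criterion: once a finite set carries all but \<open>d\<close> of the sum of \<open>g\<close>, adding further terms of
  \<open>f\<close> changes the partial sum by at most \<open>sqrt (C * d)\<close>.
\<close>

lemma summable_on_of_norm_sum_bound:
  fixes f :: "'i \<Rightarrow> 'h::banach" and g :: "'i \<Rightarrow> real"
  assumes g: "g summable_on A" "\<And>i. i \<in> A \<Longrightarrow> g i \<ge> 0" and "C \<ge> 0"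
    and bound: "\<And>F. finite F \<Longrightarrow> F \<subseteq> A \<Longrightarrow> (norm (sum f F))\<^sup>2 \<le> C * sum g F"
  shows "f summable_on A"
proof -
  define S where "S = infsum g A"
  have "\<exists>P. eventually P (finite_subsets_at_top A) \<and>
              (\<forall>F F'. P F \<and> P F' \<longrightarrow> dist (sum f F) (sum f F') < e)" if "e > 0" for e
  proof -
    \<comment> \<open>dividing by \<open>C + 1\<close> instead of \<open>C\<close> covers \<open>C = 0\<close>\<close>
    define d where "d = (e / 2)\<^sup>2 / (C + 1)"
    have "d > 0" unfolding d_def using that \<open>C \<ge> 0\<close> by (intro divide_pos_pos) auto
    then obtain F0 where F0: "finite F0" "F0 \<subseteq> A" "dist (sum g F0) S \<le> d"
      using infsum_finite_approximation[OF g(1)] unfolding S_def by blast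
    define P where "P F \<longleftrightarrow> finite F \<and> F0 \<subseteq> F \<and> F \<subseteq> A" for F
    have near: "dist (sum f F) (sum f F0) < e / 2" if "P F" for F
    proof -
      have F: "finite F" "F0 \<subseteq> F" "F \<subseteq> A" using that by (auto simp: P_def)
      have "(dist (sum f F) (sum f F0))\<^sup>2 = (norm (sum f (F - F0)))\<^sup>2"
        using F by (simp add: dist_norm sum_diff)
      also have "\<dots> \<le> C * sum g (F - F0)" using F by (intro bound) auto
      also have "sum g (F - F0) = sum g F - sum g F0" using F by (simp add: sum_diff)
      also have "C * (sum g F - sum g F0) \<le> C * d"
      proof (intro mult_left_mono \<open>C \<ge> 0\<close>)
        have "sum g F \<le> S" unfolding S_def using F g by (intro finite_sum_le_infsum) auto
        then show "sum g F - sum g F0 \<le> d" using F0(3) by (auto simp: dist_real_def)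
      qed
      also have "\<dots> < (C + 1) * d" using \<open>d > 0\<close> by simp
      also have "\<dots> = (e / 2)\<^sup>2" using \<open>C \<ge> 0\<close> by (simp add: d_def)
      finally show ?thesis using \<open>e > 0\<close> by (intro power2_less_imp_less[of _ "e / 2"]) auto
    qed
    have "eventually P (finite_subsets_at_top A)"
      unfolding P_def eventually_finite_subsets_at_top using F0 by blast
    moreover have "dist (sum f F) (sum f F') < e" if "P F" "P F'" for F F'
      using near[OF that(1)] near[OF that(2)] dist_triangle_half_l by blast
    ultimately show ?thesis by blast
  qed
  then have "cauchy_filter (filtermap (sum f) (finite_subsets_at_top A))"
    by (simp add: cauchy_filter_metric_filtermap)
  then obtain L where "(sum f \<longlongrightarrow> L) (finite_subsets_at_top A)"
    using complete_uniform[where S=UNIV] complete_UNIV by (force simp add: filterlim_def)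
  then show ?thesis using summable_on_def has_sum_def by blast
qed

section \<open>The scalar-valued inner product and its real part\<close>

lemma inner_one_one: "(1::'k::{real_normed_field,euclidean_space}) \<bullet> 1 = 1"
  by (simp add: dot_square_norm)

lemma inner_of_real_one: "(of_real r :: 'k::{real_normed_field,euclidean_space}) \<bullet> 1 = r"
  by (simp add: of_real_def inner_one_one)

lemma conjugate_0 [simp]: "conjugate (0::'k::{real_normed_field,euclidean_space}) = 0"
  by (simp add: conjugate_def)

lemma conjugate_add: "conjugate (x + y) = conjugate x + conjugate (y::'k::{real_normed_field,euclidean_space})"
  by (simp add: conjugate_def inner_add_left distrib_left)

lemma inner_conjugate_one: "conjugate (z::'k::{real_normed_field,euclidean_space}) \<bullet> 1 = z \<bullet> 1"
  by (simp add: conjugate_def inner_diff_left inner_of_real_one del: of_real_mult)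

text \<open>
  Conjugation is the reflection in the line spanned by \<open>1\<close>.
\<close>

lemma norm_conjugate: "norm (conjugate (z::'k::{real_normed_field,euclidean_space})) = norm z"
proof -
  define t where "t = z \<bullet> 1"
  have "1 \<bullet> z = t" by (simp add: t_def inner_commute)
  have "conjugate z = (2 * t) *\<^sub>R 1 - z"
    unfolding conjugate_def of_real_def t_def ..
  then have "conjugate z \<bullet> conjugate z = z \<bullet> z"
    using \<open>1 \<bullet> z = t\<close>
    by (simp add: inner_diff_left inner_diff_right inner_one_one t_def[symmetric]
        del: scaleR_conv_of_real)
  then show ?thesis by (simp add: norm_eq_sqrt_inner)
qed

context hilbert_space
begin

lemma ip_add_right: "ip x (y + z) = ip x y + ip x z"
  by (metis ip_commute ip_add_left conjugate_add)

text \<open>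
  Polarization, comparing real parts in the expansion of \<open>ip (x + y) (x + y)\<close>.
\<close>

lemma re_ip: "ip x y \<bullet> 1 = inner x y"
proof -
  have "of_real ((norm (x + y))\<^sup>2) = ip x x + ip x y + (conjugate (ip x y) + ip y y)"
    unfolding ip_self[symmetric] ip_add_left ip_add_right by (simp add: ip_commute[of y x])
  from arg_cong[OF this, of "\<lambda>z. z \<bullet> 1"]
  have "(norm (x + y))\<^sup>2 = (norm x)\<^sup>2 + 2 * (ip x y \<bullet> 1) + (norm y)\<^sup>2"
    by (simp only: ip_self inner_add_left inner_of_real_one inner_conjugate_one)
  then show ?thesis
    by (simp add: power2_norm_eq_inner inner_add_left inner_add_right inner_commute)
qed

text \<open>
  The real inner product determines the scalar one: the real parts of all multiples of a scalar
  determine it, and multiples can be moved into the first argument. This is the device by which facts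
  about \<open>inner\<close> are lifted to \<open>ip\<close>.
\<close>

lemma ip_eqI:
  assumes "\<And>c. inner (smul c x) y = inner (smul c x') y'"
  shows "ip x y = ip x' y'"
proof (rule ccontr)
  define z where "z = ip x y - ip x' y'"
  assume "ip x y \<noteq> ip x' y'"
  then have "1 = (inverse z * z) \<bullet> 1" by (simp add: z_def inner_one_one)
  also have "\<dots> = inner (smul (inverse z) x) y - inner (smul (inverse z) x') y'"
    by (simp add: z_def right_diff_distrib inner_diff_left re_ip ip_scale_left flip: ip_scale_left)
  \<comment> \<open>the real part of \<open>1\<close> is \<open>1\<close>, but equals a difference of two equal numbers\<close>
  finally show False using assms by simp
qed

lemma ip_zero_right [simp]: "ip x 0 = 0"
  using ip_add_right[of x 0 0] by simp

lemma ip_zero_left [simp]: "ip 0 x = 0"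
  using ip_add_left[of 0 0 x] by simp

text \<open>
  Taking norms in \<open>ip (smul c x) (smul c x) = c * conjugate (c * ip x x)\<close> gives this without
  computing \<open>c * conjugate c\<close>.
\<close>

lemma norm_smul: "norm (smul c x) = norm c * norm x"
proof -
  have "of_real ((norm (smul c x))\<^sup>2) = c * conjugate (c * of_real ((norm x)\<^sup>2))"
    by (metis ip_self ip_scale_left ip_commute)
  then have "norm (of_real ((norm (smul c x))\<^sup>2) :: 'k) = norm (c * conjugate (c * of_real ((norm x)\<^sup>2)))"
    by simp
  then have "(norm (smul c x))\<^sup>2 = (norm c * norm x)\<^sup>2"
    by (simp add: norm_mult norm_conjugate power2_eq_square)
  then show ?thesis by (simp add: power2_eq_iff_nonneg)
qed

text \<open>
  Cauchy-Schwarz for the scalar inner product reduces to the real one after \<open>x\<close> is multiplied by the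
  scalar that turns \<open>ip x y\<close> into \<open>1\<close>. It is what allows \<open>ip\<close> to be exchanged with infinite sums.
\<close>

lemma norm_ip_le: "norm (ip x y) \<le> norm x * norm y"
proof (cases "ip x y = 0")
  case False
  have "1 = (inverse (ip x y) * ip x y) \<bullet> 1" using False by (simp add: inner_one_one)
  also have "\<dots> = inner (smul (inverse (ip x y)) x) y" by (simp only: re_ip flip: ip_scale_left)
  also have "\<dots> \<le> norm (smul (inverse (ip x y)) x) * norm y" by (rule norm_cauchy_schwarz)
  also have "\<dots> = norm x * norm y / norm (ip x y)" unfolding norm_smul norm_inverse by (simp add: field_simps)
  finally show ?thesis using False by (simp add: field_simps)
qed simp

lemma ip_scaleR_left: "ip (r *\<^sub>R x) y = r *\<^sub>R ip x y"
  by (simp add: ip_scale_left scaleR_conv_of_real flip: scale_of_real)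

lemma bounded_linear_ip_left: "bounded_linear (\<lambda>x. ip x y)"
  by (rule bounded_linear_intro[of _ "norm y"]) (auto simp: ip_add_left ip_scaleR_left norm_ip_le)

lemma real_subspace: "subspace M \<Longrightarrow> real_vector.subspace M"
  unfolding subspace_def real_vector.subspace_def by (metis scale_of_real)

lemma bounded_operator_bounded_linear:
  assumes "bounded_operator smul K"
  shows "bounded_linear K"
proof -
  obtain C where C: "\<And>x. norm (K x) \<le> C * norm x" and lin: "Vector_Spaces.linear smul smul K"
    using assms unfolding bounded_operator_def by blast
  interpret K: Vector_Spaces.linear smul smul K by fact
  show ?thesis
    using C by (intro bounded_linear_intro[of _ C])
      (auto simp: K.add K.scale mult.commute simp flip: scale_of_real)
qed

lemma bounded_operator_smul: "bounded_operator smul K \<Longrightarrow> K (smul c x) = smul c (K x)"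
  unfolding bounded_operator_def by (simp add: module_hom.scale flip: module_hom_iff_linear)

lemma bounded_operatorI:
  assumes "\<And>x y. K (x + y) = K x + K y" "\<And>c x. K (smul c x) = smul c (K x)"
    "\<And>x. norm (K x) \<le> C * norm x"
  shows "bounded_operator smul K"
  using assms unfolding bounded_operator_def module_hom_iff_linear[symmetric]
  by (auto intro!: module_hom.intro module_hom_axioms.intro module_axioms)

section \<open>Orthogonal projections and adjoints\<close>

context
  fixes M :: "'h set"
  assumes M: "subspace M" "closed M"
begin

lemma ip_residual_eq_0:
  assumes "\<And>u. u \<in> M \<Longrightarrow> inner r u = 0" and "u \<in> M"
  shows "ip r u = 0"
proof -
  have "ip u r = ip 0 r"
    using assms subspace_scale[OF M(1)] by (intro ip_eqI) (simp add: inner_commute[of _ r])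
  then show ?thesis by (simp add: ip_commute[of r u])
qed

text \<open>
  Real orthogonality suffices because \<open>M\<close> is closed under all scalars.
\<close>

lemma orth_proj_eqI:
  assumes "p \<in> M" and "\<And>u. u \<in> M \<Longrightarrow> inner (f - p) u = 0"
  shows "orth_proj ip M f = p"
  unfolding orth_proj_def
proof (rule the_equality)
  show "p \<in> M \<and> (\<forall>u\<in>M. ip (f - p) u = 0)"
    using assms ip_residual_eq_0 by blast
next
  fix q assume q: "q \<in> M \<and> (\<forall>u\<in>M. ip (f - q) u = 0)"
  have "p - q \<in> M" using q assms subspace_diff[OF M(1)] by blast
  then have "inner (f - q) (p - q) = 0" "inner (f - p) (p - q) = 0"
    using q assms(2) by (auto simp: inner_one_one simp flip: re_ip)
  then have "inner (p - q) (p - q) = 0" by (simp add: inner_diff_left)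
  then show "q = p" by simp
qed

lemma
  shows orth_proj_in: "orth_proj ip M f \<in> M"
    and inner_residual: "u \<in> M \<Longrightarrow> inner (f - orth_proj ip M f) u = 0"
proof -
  obtain p where p: "p \<in> M" "\<And>u. u \<in> M \<Longrightarrow> inner (f - p) u = 0"
    using orthogonal_projection_exists[OF real_subspace[OF M(1)] M(2)] by blast
  moreover have "orth_proj ip M f = p" using p by (rule orth_proj_eqI)
  ultimately show "orth_proj ip M f \<in> M"
    and "u \<in> M \<Longrightarrow> inner (f - orth_proj ip M f) u = 0" by auto
qed

lemma orth_proj_id: "f \<in> M \<Longrightarrow> orth_proj ip M f = f"
  by (rule orth_proj_eqI) auto

lemma orth_proj_add: "orth_proj ip M (f + g) = orth_proj ip M f + orth_proj ip M g"
proof (rule orth_proj_eqI)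
  show "orth_proj ip M f + orth_proj ip M g \<in> M"
    by (intro subspace_add M orth_proj_in)
  fix u assume "u \<in> M"
  then show "inner (f + g - (orth_proj ip M f + orth_proj ip M g)) u = 0"
    using inner_residual[of u f] inner_residual[of u g]
    by (simp add: inner_add_left inner_diff_left)
qed

lemma orth_proj_smul: "orth_proj ip M (smul c f) = smul c (orth_proj ip M f)"
proof (rule orth_proj_eqI)
  show "smul c (orth_proj ip M f) \<in> M"
    by (intro subspace_scale M orth_proj_in)
  fix u assume "u \<in> M"
  then have "ip (smul c (f - orth_proj ip M f)) u = 0"
    by (simp add: ip_scale_left ip_residual_eq_0 inner_residual)
  then show "inner (smul c f - smul c (orth_proj ip M f)) u = 0"
    by (metis scale_right_diff_distrib re_ip inner_zero_left)
qed

lemma inner_orth_proj_left: "u \<in> M \<Longrightarrow> inner (orth_proj ip M f) u = inner f u"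
  using inner_residual[of u f] by (simp add: inner_diff_left)

lemma orth_proj_symmetric: "inner (orth_proj ip M f) g = inner f (orth_proj ip M g)"
  using inner_orth_proj_left[OF orth_proj_in, of f g] inner_orth_proj_left[OF orth_proj_in, of g f]
  by (simp add: inner_commute)

lemma norm_orth_proj_le: "norm (orth_proj ip M f) \<le> norm f"
proof -
  have "norm (orth_proj ip M f) * norm (orth_proj ip M f) = inner f (orth_proj ip M f)"
    using inner_orth_proj_left[OF orth_proj_in, of f f] by (simp add: dot_square_norm power2_eq_square)
  also have "\<dots> \<le> norm f * norm (orth_proj ip M f)" by (rule norm_cauchy_schwarz)
  finally show ?thesis by (cases "orth_proj ip M f = 0") auto
qed

end

lemma inner_adj:
  assumes K: "bounded_operator smul K"
  shows "inner (K x) y = inner x (adj ip K y)"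
proof -
  obtain A where A: "\<And>x y. inner (K x) y = inner x (A y)"
    using real_adjoint_exists[OF bounded_operator_bounded_linear[OF K]] by blast
  have "adj ip K y = A y"
    unfolding adjoint_on_def
  proof (rule the_equality)
    show "A y \<in> UNIV \<and> (\<forall>u\<in>UNIV. ip (K u) y = ip u (A y))"
      by (auto intro!: ip_eqI simp: A simp flip: bounded_operator_smul[OF K])
    fix z assume z: "z \<in> UNIV \<and> (\<forall>u\<in>UNIV. ip (K u) y = ip u z)"
    have "inner u z = inner u (A y)" for u
      using z by (metis A re_ip UNIV_I)
    then show "z = A y" using vector_eq_ldot by blast
  qed
  then show ?thesis by (simp add: A)
qed

section \<open>The Moore-Penrose inverse of an operator with closed range\<close>

definition penrose_inverse :: "('h \<Rightarrow> 'h) \<Rightarrow> ('h \<Rightarrow> 'h) \<Rightarrow> bool" where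
  "penrose_inverse K L \<longleftrightarrow> bounded_operator smul L \<and>
     (\<forall>x. K (L (K x)) = K x) \<and> (\<forall>x. L (K (L x)) = L x) \<and>
     (\<forall>x y. ip (K (L x)) y = ip x (K (L y))) \<and> (\<forall>x y. ip (L (K x)) y = ip x (L (K y)))"

text \<open>
  \<open>K L\<close> and \<open>K L'\<close> are self-adjoint projections onto the same range, hence
  \<open>K L = (K L' K L)\<^sup>* = K L K L' = K L'\<close>, and likewise \<open>L K = L' K\<close>. Therefore
  \<open>L = L K L = L' K L = L' K L' = L'\<close>.
\<close>

lemma penrose_inverse_unique:
  assumes L: "penrose_inverse K L" and L': "penrose_inverse K L'"
  shows "L = L'"
proof
  have id: "K (L (K x)) = K x" "L (K (L x)) = L x" "K (L' (K x)) = K x" "L' (K (L' x)) = L' x" for x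
    using L L' unfolding penrose_inverse_def by blast+
  have "ip (K (L x)) y = ip x (K (L y))" "ip (L (K x)) y = ip x (L (K y))"
     "ip (K (L' x)) y = ip x (K (L' y))" "ip (L' (K x)) y = ip x (L' (K y))" for x y
    using L L' unfolding penrose_inverse_def by blast+
  then have inner: "inner (K (L x)) y = inner x (K (L y))" "inner (L (K x)) y = inner x (L (K y))"
     "inner (K (L' x)) y = inner x (K (L' y))" "inner (L' (K x)) y = inner x (L' (K y))" for x y
    unfolding re_ip[symmetric] by metis+
  have KL: "K (L x) = K (L' x)" for x
  proof (rule vector_eq_rdot[THEN iffD1, rule_format])
    fix y
    have "inner (K (L x)) y = inner (K (L' (K (L x)))) y" by (simp only: id)
    also have "\<dots> = inner x (K (L (K (L' y))))" by (simp only: inner)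
    also have "\<dots> = inner (K (L' x)) y" by (simp only: id inner)
    finally show "inner (K (L x)) y = inner (K (L' x)) y" .
  qed
  have LK: "L (K x) = L' (K x)" for x
  proof (rule vector_eq_rdot[THEN iffD1, rule_format])
    fix y
    have "inner (L (K x)) y = inner (L (K (L' (K x)))) y" by (simp only: id)
    also have "\<dots> = inner x (L' (K (L (K y))))" by (simp only: inner)
    also have "\<dots> = inner (L' (K x)) y" by (simp only: id inner)
    finally show "inner (L (K x)) y = inner (L' (K x)) y" .
  qed
  fix x
  have "L x = L (K (L x))" by (simp only: id)
  also have "\<dots> = L' (K (L' x))" by (simp only: LK KL)
  also have "\<dots> = L' x" by (simp only: id)
  finally show "L x = L' x" .
qed

text \<open>
  \<open>L y\<close> is the solution \<open>x\<close> of \<open>K x = P y\<close> that is orthogonal to the kernel \<open>N\<close> of \<open>K\<close>, where \<open>P\<close> is the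
  projection onto the range. This solution is unique, which gives linearity and all the algebraic
  identities, since \<open>K L = P\<close> and \<open>L K\<close> is the projection onto the complement of \<open>N\<close>. Boundedness is
  \<open>bounded_below_on_kernel_complement\<close>.
\<close>

lemma penrose_inverse_exists:
  assumes K: "bounded_operator smul K" and closed_range: "closed (range K)"
  shows "\<exists>L. penrose_inverse K L"
proof -
  interpret K: bounded_linear K by (rule bounded_operator_bounded_linear[OF K])
  define N where "N = {x. K x = 0}"
  have N: "subspace N" "closed N"
  proof -
    show "subspace N"
      unfolding N_def subspace_def using bounded_operator_smul[OF K]
      by (simp add: K.add K.zero)
    show "closed N" unfolding N_def
      by (intro closed_Collect_eq continuous_intros K.continuous_on)
  qed
  have R: "subspace (range K)"
  proof (rule subspaceI)
    show "0 \<in> range K" by (metis K.zero rangeI)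
  qed (auto simp flip: K.add bounded_operator_smul[OF K])
  define P where "P = orth_proj ip (range K)"
  define Q where "Q = orth_proj ip N"
  have pre: "\<exists>x. K x = P y \<and> Q x = 0" for y
  proof -
    obtain x where x: "P y = K x" using orth_proj_in[OF R closed_range, of y] by (auto simp: P_def)
    have "Q x \<in> N" unfolding Q_def by (rule orth_proj_in[OF N])
    then have "K (x - Q x) = P y" by (simp add: x K.diff N_def)
    moreover have "Q (x - Q x) = 0"
      unfolding Q_def
      by (rule orth_proj_eqI[OF N subspace_0[OF N(1)]]) (simp add: inner_residual[OF N])
    ultimately show ?thesis by blast
  qed
  then obtain L where L: "\<And>y. K (L y) = P y" "\<And>y. Q (L y) = 0" by metis
  have L_eqI: "L y = x" if "K x = P y" "Q x = 0" for x y
  proof -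
    have d: "L y - x \<in> N" using that L by (simp add: N_def K.diff)
    have "Q (L y - x) = L y - x" unfolding Q_def by (rule orth_proj_id[OF N d])
    moreover have "Q (L y - x) + Q x = Q (L y)"
      unfolding Q_def orth_proj_add[OF N, symmetric] by simp
    ultimately show ?thesis using L(2) that(2) by simp
  qed
  obtain C where C: "C \<ge> 0" "\<And>x. (\<And>n. K n = 0 \<Longrightarrow> inner x n = 0) \<Longrightarrow> norm x \<le> C * norm (K x)"
    using bounded_below_on_kernel_complement[OF K.bounded_linear_axioms closed_range] by blast
  have bounded: "bounded_operator smul L"
  proof (rule bounded_operatorI)
    show "L (x + y) = L x + L y" for x y
      using L by (intro L_eqI) (simp_all add: K.add P_def Q_def orth_proj_add[OF N] orth_proj_add[OF R closed_range])
    show "L (smul c x) = smul c (L x)" for c x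
      using L by (intro L_eqI) (simp_all add: bounded_operator_smul[OF K] P_def Q_def
          orth_proj_smul[OF N] orth_proj_smul[OF R closed_range])
    show "norm (L x) \<le> C * norm x" for x
    proof -
      have "norm (L x) \<le> C * norm (K (L x))"
        using inner_residual[OF N, of _ "L x"] L(2)[of x] by (intro C(2)) (simp add: N_def Q_def)
      also have "\<dots> \<le> C * norm x"
        unfolding L(1) P_def by (intro mult_left_mono C(1) norm_orth_proj_le[OF R closed_range])
      finally show ?thesis .
    qed
  qed
  have PK: "P (K x) = K x" for x
    unfolding P_def by (rule orth_proj_id[OF R closed_range]) simp
  have LP: "L (P x) = L x" for x
    by (rule L_eqI) (use PK[of "L x"] in \<open>simp_all only: L\<close>)
  have LK: "L (K x) = x - Q x" for x
  proof (rule L_eqI)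
    have "Q x \<in> N" unfolding Q_def by (rule orth_proj_in[OF N])
    then show "K (x - Q x) = P (K x)" by (simp add: PK K.diff N_def)
    show "Q (x - Q x) = 0"
      unfolding Q_def
      by (rule orth_proj_eqI[OF N subspace_0[OF N(1)]]) (simp add: inner_residual[OF N])
  qed
  have P_sym: "ip (P x) y = ip x (P y)" for x y
    by (rule ip_eqI) (simp add: P_def orth_proj_symmetric[OF R closed_range]
        flip: orth_proj_smul[OF R closed_range])
  have Q_sym: "ip (x - Q x) y = ip x (y - Q y)" for x y
    by (rule ip_eqI) (simp add: Q_def scale_right_diff_distrib inner_diff_left inner_diff_right
        orth_proj_symmetric[OF N] flip: orth_proj_smul[OF N])
  have "penrose_inverse K L"
    unfolding penrose_inverse_def L(1) PK LP unfolding LK using bounded P_sym Q_sym by simp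
  then show ?thesis by blast
qed

lemma penrose_inverse_pseudo_inverse:
  assumes "bounded_operator smul K" and "closed (range K)"
  shows "penrose_inverse K (pseudo_inverse smul ip K)"
proof -
  have "\<exists>!L. penrose_inverse K L"
    using penrose_inverse_exists[OF assms] penrose_inverse_unique by blast
  then have "penrose_inverse K (THE L. penrose_inverse K L)" by (rule theI')
  then show ?thesis unfolding pseudo_inverse_def penrose_inverse_def .
qed

text \<open>
  On the range of \<open>K\<close> the operator \<open>K L\<close> is the identity, so
  \<open>(norm f)\<^sup>2 = inner (K (L f)) f = inner (L f) (adj ip K f)\<close>. This is what turns the term
  \<open>c * norm f\<close> of the perturbation hypothesis into a multiple of \<open>norm (adj ip K f)\<close>.
\<close>

lemma norm_le_pseudo_inverse_adj:
  assumes K: "bounded_operator smul K" "closed (range K)" and f: "f \<in> range K"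
  shows "norm f \<le> onorm (pseudo_inverse smul ip K) * norm (adj ip K f)"
proof -
  define L where "L = pseudo_inverse smul ip K"
  have L: "penrose_inverse K L" unfolding L_def using K by (rule penrose_inverse_pseudo_inverse)
  have "K (L f) = f" using f L unfolding penrose_inverse_def by auto
  then have "norm f * norm f = inner (K (L f)) f" by (simp add: dot_square_norm power2_eq_square)
  also have "\<dots> = inner (L f) (adj ip K f)" by (rule inner_adj[OF K(1)])
  also have "\<dots> \<le> norm (L f) * norm (adj ip K f)" by (rule norm_cauchy_schwarz)
  also have "\<dots> \<le> (onorm L * norm f) * norm (adj ip K f)"
    using L bounded_operator_bounded_linear unfolding penrose_inverse_def
    by (intro mult_right_mono onorm) auto
  finally have "norm f * norm f \<le> norm f * (onorm L * norm (adj ip K f))" by (simp add: mult_ac)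
  moreover have "0 \<le> onorm L * norm (adj ip K f)"
    using L bounded_operator_bounded_linear unfolding penrose_inverse_def
    by (intro mult_nonneg_nonneg onorm_pos_le) auto
  ultimately show ?thesis unfolding L_def by (cases "f = 0") auto
qed

section \<open>The synthesis operator of a fusion Bessel sequence\<close>

context
  fixes I :: "'i set" and W :: "'i \<Rightarrow> 'h set" and w :: "'i \<Rightarrow> real" and B :: real
  assumes bessel: "fusion_bessel smul ip I W w B"
begin

lemma W_closed_subspace: "i \<in> I \<Longrightarrow> subspace (W i)" "i \<in> I \<Longrightarrow> closed (W i)"
  using bessel unfolding fusion_bessel_def closed_subspaces_def by auto

lemma B_pos: "B > 0"
  using bessel unfolding fusion_bessel_def by blast

lemma bessel_summable: "(\<lambda>i. (w i)\<^sup>2 * (norm (orth_proj ip (W i) f))\<^sup>2) summable_on I"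
  using bessel unfolding fusion_bessel_def by blast

lemma bessel_le: "(\<Sum>\<^sub>\<infinity>i\<in>I. (w i)\<^sup>2 * (norm (orth_proj ip (W i) f))\<^sup>2) \<le> B * (norm f)\<^sup>2"
  using bessel unfolding fusion_bessel_def by blast

text \<open>
  Boundedness of the synthesis operator on finitely supported families. The sum \<open>s\<close> is tested
  against itself: \<open>inner (u i) s\<close> only sees the projection of \<open>s\<close> to \<open>W i\<close>, so Cauchy-Schwarz and
  the Bessel inequality bound \<open>(norm s)\<^sup>2\<close> by a multiple of \<open>norm s\<close>, and one factor cancels.
\<close>

lemma norm_weighted_sum_le:
  assumes F: "finite F" "F \<subseteq> I" and u: "\<And>i. i \<in> F \<Longrightarrow> u i \<in> W i"
  shows "(norm (\<Sum>i\<in>F. w i *\<^sub>R u i))\<^sup>2 \<le> B * (\<Sum>i\<in>F. (norm (u i))\<^sup>2)"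
proof -
  define s where "s = (\<Sum>i\<in>F. w i *\<^sub>R u i)"
  define P where "P i = orth_proj ip (W i) s" for i
  define U where "U = (\<Sum>i\<in>F. (norm (u i))\<^sup>2)"
  have "U \<ge> 0" unfolding U_def by (intro sum_nonneg) simp
  have "norm s * norm s = (\<Sum>i\<in>F. w i * inner (u i) s)"
    by (simp add: inner_sum_left s_def flip: power2_eq_square power2_norm_eq_inner)
       (simp add: power2_norm_eq_inner inner_sum_left)
  also have "\<dots> \<le> (\<Sum>i\<in>F. \<bar>norm (u i)\<bar> * \<bar>w i * norm (P i)\<bar>)"
  proof (rule sum_mono)
    fix i assume i: "i \<in> F"
    then have "inner (u i) s = inner (u i) (P i)"
      using inner_orth_proj_left[OF W_closed_subspace u[OF i], of s] F
      unfolding P_def by (auto simp: inner_commute)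
    then have "w i * inner (u i) s \<le> \<bar>w i\<bar> * \<bar>inner (u i) (P i)\<bar>"
      by (metis abs_ge_self abs_mult)
    also have "\<dots> \<le> \<bar>w i\<bar> * (norm (u i) * norm (P i))"
      by (intro mult_left_mono Cauchy_Schwarz_ineq2) simp
    finally show "w i * inner (u i) s \<le> \<bar>norm (u i)\<bar> * \<bar>w i * norm (P i)\<bar>"
      by (simp add: abs_mult mult_ac)
  qed
  also have "\<dots> \<le> L2_set (\<lambda>i. norm (u i)) F * L2_set (\<lambda>i. w i * norm (P i)) F"
    by (rule L2_set_mult_ineq)
  also have "\<dots> \<le> sqrt U * (sqrt B * norm s)"
  proof (rule mult_mono)
    have "(\<Sum>i\<in>F. (w i)\<^sup>2 * (norm (P i))\<^sup>2) \<le> (\<Sum>\<^sub>\<infinity>i\<in>I. (w i)\<^sup>2 * (norm (P i))\<^sup>2)"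
      unfolding P_def using F by (intro finite_sum_le_infsum bessel_summable) auto
    also have "\<dots> \<le> B * (norm s)\<^sup>2" unfolding P_def by (rule bessel_le)
    finally have "L2_set (\<lambda>i. w i * norm (P i)) F \<le> sqrt (B * (norm s)\<^sup>2)"
      unfolding L2_set_def power_mult_distrib by (rule real_sqrt_le_mono)
    then show "L2_set (\<lambda>i. w i * norm (P i)) F \<le> sqrt B * norm s"
      by (simp add: real_sqrt_mult)
  qed (auto simp: L2_set_def U_def sum_nonneg)
  finally have "norm s * norm s \<le> (sqrt U * sqrt B) * norm s" by (simp add: mult_ac)
  then have "norm s \<le> sqrt U * sqrt B"
    using \<open>U \<ge> 0\<close> B_pos by (cases "s = 0") auto
  then have "(norm s)\<^sup>2 \<le> (sqrt U * sqrt B)\<^sup>2" by (intro power_mono) auto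
  also have "\<dots> = B * U" using \<open>U \<ge> 0\<close> B_pos by (simp add: power_mult_distrib)
  finally show ?thesis unfolding s_def U_def .
qed

lemma synthesis_summable:
  assumes g: "g \<in> l2_sum I W"
  shows "(\<lambda>i. w i *\<^sub>R g i) summable_on I"
proof (rule summable_on_of_norm_sum_bound)
  show "(\<lambda>i. (norm (g i))\<^sup>2) summable_on I" using g unfolding l2_sum_def by blast
  show "B \<ge> 0" using B_pos by simp
  fix F assume "finite F" "F \<subseteq> I"
  then show "(norm (\<Sum>i\<in>F. w i *\<^sub>R g i))\<^sup>2 \<le> B * (\<Sum>i\<in>F. (norm (g i))\<^sup>2)"
    using g by (intro norm_weighted_sum_le) (auto simp: l2_sum_def)
qed simp

lemma norm_synthesis_le_bessel:
  assumes g: "g \<in> l2_sum I W"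
  shows "norm (synthesis I w g) \<le> sqrt B * l2_norm I g"
proof (rule tendsto_upperbound)
  have "((\<lambda>F. \<Sum>i\<in>F. w i *\<^sub>R g i) \<longlongrightarrow> synthesis I w g) (finite_subsets_at_top I)"
    using has_sum_infsum[OF synthesis_summable[OF g]] unfolding synthesis_def has_sum_def .
  then show "((\<lambda>F. norm (\<Sum>i\<in>F. w i *\<^sub>R g i)) \<longlongrightarrow> norm (synthesis I w g)) (finite_subsets_at_top I)"
    by (rule tendsto_norm)
  show "\<forall>\<^sub>F F in finite_subsets_at_top I. norm (\<Sum>i\<in>F. w i *\<^sub>R g i) \<le> sqrt B * l2_norm I g"
  proof (rule eventually_finite_subsets_at_top_weakI)
    fix F assume F: "finite F" "F \<subseteq> I"
    have "(norm (\<Sum>i\<in>F. w i *\<^sub>R g i))\<^sup>2 \<le> B * (\<Sum>i\<in>F. (norm (g i))\<^sup>2)"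
      using g F by (intro norm_weighted_sum_le) (auto simp: l2_sum_def)
    also have "\<dots> \<le> B * (\<Sum>\<^sub>\<infinity>i\<in>I. (norm (g i))\<^sup>2)"
      using g F B_pos by (intro mult_left_mono finite_sum_le_infsum) (auto simp: l2_sum_def)
    finally show "norm (\<Sum>i\<in>F. w i *\<^sub>R g i) \<le> sqrt B * l2_norm I g"
      unfolding l2_norm_def real_sqrt_mult[symmetric] by (rule real_le_rsqrt)
  qed
qed simp

lemma l2_norm_nonneg: "l2_norm I g \<ge> 0"
  unfolding l2_norm_def by (simp add: infsum_nonneg)

text \<open>
  The Bessel bound makes the set of quotients bounded above, so that the supremum defining the norm
  is meaningful.
\<close>

lemma synthesis_quotient_le_norm:
  assumes "g \<in> l2_sum I W"
  shows "norm (synthesis I w g) / l2_norm I g \<le> synthesis_norm I W w"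
  unfolding synthesis_norm_def onorm_on_def
proof (rule cSUP_upper[OF assms], rule bdd_aboveI2)
  fix h assume "h \<in> l2_sum I W"
  then have "norm (synthesis I w h) \<le> sqrt B * l2_norm I h" by (rule norm_synthesis_le_bessel)
  then show "norm (synthesis I w h) / l2_norm I h \<le> sqrt B"
    using l2_norm_nonneg[of h] B_pos by (cases "l2_norm I h = 0") (auto simp: field_simps)
qed

lemma norm_synthesis_le:
  assumes "g \<in> l2_sum I W"
  shows "norm (synthesis I w g) \<le> synthesis_norm I W w * l2_norm I g"
proof (cases "l2_norm I g = 0")
  case True
  then show ?thesis using norm_synthesis_le_bessel[OF assms] by simp
next
  case False
  then show ?thesis
    using synthesis_quotient_le_norm[OF assms] l2_norm_nonneg[of g] by (simp add: field_simps)
qed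

lemma synthesis_norm_nonneg: "synthesis_norm I W w \<ge> 0"
proof -
  have "(\<lambda>_. 0) \<in> l2_sum I W"
    unfolding l2_sum_def using W_closed_subspace subspace_0 by auto
  from synthesis_quotient_le_norm[OF this] show ?thesis
    by (simp add: synthesis_def)
qed

definition weighted_projections :: "'h \<Rightarrow> 'i \<Rightarrow> 'h" where
  "weighted_projections f i = (if i \<in> I then w i *\<^sub>R orth_proj ip (W i) f else 0)"

lemma norm_weighted_projections:
  "i \<in> I \<Longrightarrow> (norm (weighted_projections f i))\<^sup>2 = (w i)\<^sup>2 * (norm (orth_proj ip (W i) f))\<^sup>2"
  by (simp add: weighted_projections_def power_mult_distrib)

lemma weighted_projections_in_l2_sum: "weighted_projections f \<in> l2_sum I W"
proof -
  have "(\<lambda>i. (norm (weighted_projections f i))\<^sup>2) summable_on I"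
    using bessel_summable[of f] by (simp add: norm_weighted_projections cong: summable_on_cong)
  moreover have "weighted_projections f i \<in> W i" if "i \<in> I" for i
    using that subspace_scale[OF _ orth_proj_in, of "W i" "of_real (w i)"] W_closed_subspace
    by (simp add: weighted_projections_def scale_of_real)
  ultimately show ?thesis by (simp add: l2_sum_def weighted_projections_def)
qed

lemma l2_norm_weighted_projections:
  "(l2_norm I (weighted_projections f))\<^sup>2 = (\<Sum>\<^sub>\<infinity>i\<in>I. (w i)\<^sup>2 * (norm (orth_proj ip (W i) f))\<^sup>2)"
proof -
  have "(\<Sum>\<^sub>\<infinity>i\<in>I. (norm (weighted_projections f i))\<^sup>2)
      = (\<Sum>\<^sub>\<infinity>i\<in>I. (w i)\<^sup>2 * (norm (orth_proj ip (W i) f))\<^sup>2)"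
    by (rule infsum_cong) (rule norm_weighted_projections)
  moreover have "(\<Sum>\<^sub>\<infinity>i\<in>I. (w i)\<^sup>2 * (norm (orth_proj ip (W i) f))\<^sup>2) \<ge> 0"
    by (intro infsum_nonneg) simp
  ultimately show ?thesis by (simp add: l2_norm_def)
qed

lemma ip_synthesis:
  assumes g: "g \<in> l2_sum I W"
  shows "ip (synthesis I w g) f = l2_ip ip I g (weighted_projections f)"
proof -
  have "ip (synthesis I w g) f = (\<Sum>\<^sub>\<infinity>i\<in>I. ip (w i *\<^sub>R g i) f)"
    unfolding synthesis_def
    by (intro infsumI[symmetric] has_sum_bounded_linear[OF bounded_linear_ip_left]
        has_sum_infsum synthesis_summable g)
  also have "\<dots> = (\<Sum>\<^sub>\<infinity>i\<in>I. ip (g i) (weighted_projections f i))"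
  proof (rule infsum_cong, rule ip_eqI)
    fix i c assume i: "i \<in> I"
    have "g i \<in> W i" using g i by (simp add: l2_sum_def)
    then have "smul c (g i) \<in> W i" by (rule subspace_scale[OF W_closed_subspace(1)[OF i]])
    then have "inner (smul c (g i)) (orth_proj ip (W i) f) = inner (smul c (g i)) f"
      using inner_orth_proj_left[OF W_closed_subspace[OF i]] by (simp add: inner_commute)
    moreover have "smul c (w i *\<^sub>R g i) = w i *\<^sub>R smul c (g i)"
      by (simp add: mult.commute flip: scale_of_real)
    ultimately show "inner (smul c (w i *\<^sub>R g i)) f = inner (smul c (g i)) (weighted_projections f i)"
      using i by (simp add: weighted_projections_def)
  qed
  finally show ?thesis unfolding l2_ip_def .
qed

lemma l2_ip_single:
  assumes "i \<in> I"
  shows "l2_ip ip I ((\<lambda>_. 0)(i := v)) g = ip v (g i)"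
proof -
  have "l2_ip ip I ((\<lambda>_. 0)(i := v)) g = (\<Sum>\<^sub>\<infinity>j\<in>{i}. ip (((\<lambda>_. 0)(i := v)) j) (g j))"
    unfolding l2_ip_def using assms by (intro infsum_cong_neutral) auto
  then show ?thesis by simp
qed

lemma single_in_l2_sum:
  assumes "i \<in> I" "v \<in> W i"
  shows "(\<lambda>_. 0)(i := v) \<in> l2_sum I W"
proof -
  have "(\<lambda>j. (norm (((\<lambda>_. 0)(i := v)) j))\<^sup>2) summable_on I \<longleftrightarrow>
      (\<lambda>j. (norm (((\<lambda>_. 0)(i := v)) j))\<^sup>2) summable_on {i}"
    using assms by (intro summable_on_cong_neutral) auto
  then show ?thesis
    using assms W_closed_subspace subspace_0 by (auto simp: l2_sum_def)
qed

text \<open>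
  The weighted projections satisfy the adjoint identity, and a family satisfying it is determined
  componentwise by testing on families with a single nonzero entry.
\<close>

lemma synthesis_adj_eq: "synthesis_adj ip I W w f = weighted_projections f"
  unfolding synthesis_adj_def adjoint_on_def
proof (rule the_equality)
  show "weighted_projections f \<in> l2_sum I W \<and>
      (\<forall>u\<in>l2_sum I W. ip (synthesis I w u) f = l2_ip ip I u (weighted_projections f))"
    using weighted_projections_in_l2_sum ip_synthesis by blast
  fix g
  assume g: "g \<in> l2_sum I W \<and> (\<forall>u\<in>l2_sum I W. ip (synthesis I w u) f = l2_ip ip I u g)"
  show "g = weighted_projections f"
  proof
    fix i
    let ?h = "weighted_projections f"
    show "g i = ?h i"
    proof (cases "i \<in> I")
      case True
      define v where "v = g i - ?h i"
      have "v \<in> W i"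
        using g weighted_projections_in_l2_sum[of f] subspace_diff[OF W_closed_subspace(1)[OF True]] True
        by (simp add: v_def l2_sum_def)
      then have "(\<lambda>_. 0)(i := v) \<in> l2_sum I W" by (rule single_in_l2_sum[OF True])
      then have "l2_ip ip I ((\<lambda>_. 0)(i := v)) g = l2_ip ip I ((\<lambda>_. 0)(i := v)) ?h"
        using g ip_synthesis by metis
      then have "ip v (g i) = ip v (?h i)" by (simp only: l2_ip_single[OF True])
      then have "inner v (g i - ?h i) = 0" by (metis re_ip inner_diff_right cancel_comm_monoid_add_class.diff_cancel)
      then show ?thesis by (simp add: v_def)
    next
      case False
      then show ?thesis using g by (simp add: l2_sum_def weighted_projections_def)
    qed
  qed
qed

end

lemma fusion_bessel_subset:
  assumes "fusion_bessel smul ip I W w B" and "I' \<subseteq> I"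
  shows "fusion_bessel smul ip I' W w B"
proof -
  have "(\<lambda>i. (w i)\<^sup>2 * (norm (orth_proj ip (W i) f))\<^sup>2) summable_on I'" for f
    using bessel_summable[OF assms(1)] assms(2) by (rule summable_on_subset_banach)
  moreover have "(\<Sum>\<^sub>\<infinity>i\<in>I'. (w i)\<^sup>2 * (norm (orth_proj ip (W i) f))\<^sup>2) \<le> B * (norm f)\<^sup>2" for f
  proof -
    have "(\<Sum>\<^sub>\<infinity>i\<in>I'. (w i)\<^sup>2 * (norm (orth_proj ip (W i) f))\<^sup>2)
        \<le> (\<Sum>\<^sub>\<infinity>i\<in>I. (w i)\<^sup>2 * (norm (orth_proj ip (W i) f))\<^sup>2)"
      using calculation bessel_summable[OF assms(1)] assms(2) by (intro infsum_mono2) auto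
    also have "\<dots> \<le> B * (norm f)\<^sup>2" by (rule bessel_le[OF assms(1)])
    finally show ?thesis .
  qed
  ultimately show ?thesis
    using assms unfolding fusion_bessel_def closed_subspaces_def by blast
qed

end

section \<open>The lower frame bound\<close>

theorem theorem4p7:
  fixes smul :: "'k::{real_normed_field,euclidean_space} \<Rightarrow> 'h::{real_inner,banach} \<Rightarrow> 'h"
    and ip :: "'h \<Rightarrow> 'h \<Rightarrow> 'k"
    and I J :: "'i set"
    and W :: "'i \<Rightarrow> 'h set"
    and w :: "'i \<Rightarrow> real"
    and K :: "'h \<Rightarrow> 'h"
    and a b c B :: real
  assumes "hilbert_space smul ip"
    and "separable_space (euclidean :: 'h topology)"
    and "countable I"
    and "fusion_bessel smul ip I W w B"
    and "J \<subset> I"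
    and "a \<ge> 0" and "b \<ge> 0" and "c \<ge> 0"
    and "bounded_operator smul K"
    and "closed (range K)"
    and "\<And>f. norm (adj ip K f - synthesis (I - J) w (synthesis_adj ip (I - J) W w f))
              \<le> a * norm (adj ip K f) + b * l2_norm (I - J) (synthesis_adj ip (I - J) W w f)
                 + c * norm f"
    and "a + c * onorm (pseudo_inverse smul ip K) < 1"
    and "b + synthesis_norm (I - J) W w \<noteq> 0"
  shows "K_fusion_frame_on_range smul ip K (I - J) W w
           (((1 - a - c * onorm (pseudo_inverse smul ip K)) / (b + synthesis_norm (I - J) W w))\<^sup>2) B"
proof -
  interpret hilbert_space smul ip by fact
  define k where "k = onorm (pseudo_inverse smul ip K)"
  define t where "t = synthesis_norm (I - J) W w"
  define q where "q = (1 - a - c * k) / (b + t)"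
  have bessel: "fusion_bessel smul ip (I - J) W w B"
    by (rule fusion_bessel_subset[OF assms(4)]) simp
  have "b + t > 0"
    using synthesis_norm_nonneg[OF bessel] assms(7,13) by (simp add: t_def)
  then have "q > 0" unfolding q_def using assms(12) by (simp add: k_def)
  have lower: "q\<^sup>2 * (norm (adj ip K f))\<^sup>2
      \<le> (\<Sum>\<^sub>\<infinity>i\<in>I - J. (w i)\<^sup>2 * (norm (orth_proj ip (W i) f))\<^sup>2)" if f: "f \<in> range K" for f
  proof -
    define g where "g = synthesis_adj ip (I - J) W w f"
    define x where "x = norm (adj ip K f)"
    define y where "y = l2_norm (I - J) g"
    have g: "g \<in> l2_sum (I - J) W"
      unfolding g_def synthesis_adj_eq[OF bessel] by (rule weighted_projections_in_l2_sum[OF bessel])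
    have y: "y\<^sup>2 = (\<Sum>\<^sub>\<infinity>i\<in>I - J. (w i)\<^sup>2 * (norm (orth_proj ip (W i) f))\<^sup>2)"
      unfolding y_def g_def synthesis_adj_eq[OF bessel] by (rule l2_norm_weighted_projections[OF bessel])
    \<comment> \<open>the perturbation hypothesis at \<open>f\<close>, followed by absorbing \<open>c * norm f\<close> into \<open>x\<close>\<close>
    have "x \<le> norm (adj ip K f - synthesis (I - J) w g) + norm (synthesis (I - J) w g)"
      unfolding x_def by (metis diff_add_cancel norm_triangle_ineq)
    also have "\<dots> \<le> (a * x + b * y + c * norm f) + t * y"
      unfolding x_def y_def t_def g_def[symmetric]
      using assms(11)[of f] norm_synthesis_le[OF bessel g] by (intro add_mono) (simp_all add: g_def)
    also have "c * norm f \<le> c * (k * x)"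
      unfolding k_def x_def
      by (intro mult_left_mono norm_le_pseudo_inverse_adj assms f)
    finally have "(1 - a - c * k) * x \<le> (b + t) * y" by (simp add: algebra_simps)
    then have "q * x \<le> y"
      using \<open>b + t > 0\<close> by (simp add: q_def field_simps)
    then have "(q * x)\<^sup>2 \<le> y\<^sup>2" using \<open>q > 0\<close> by (intro power_mono) (auto simp: x_def)
    then show ?thesis by (simp only: y power_mult_distrib x_def)
  qed
  have "closed_subspaces smul (I - J) W" "B > 0"
    using bessel unfolding fusion_bessel_def by auto
  then show ?thesis
    unfolding K_fusion_frame_on_range_def k_def[symmetric] t_def[symmetric] q_def[symmetric]
    using \<open>q > 0\<close> lower bessel_summable[OF bessel] bessel_le[OF bessel] by simp
qed

end
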